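(* Let $(X,d)$ be a separable ultra-metric space in which all closed balls are compact, let $\mu$ be a Radon measure on $X$ with full support, and let $\sigma$ be a distance distribution function. Let $d_*$ be the intrinsic ultra-metric defined by $\frac1{d_*(x,y)}=\log\frac1{\sigma(d(x,y))}$ and let $\sigma_*(r)=\exp(-1/r)$ for $r>0$. Then: (a) The triples $(d,\mu,\sigma)$ and $(d_*,\mu,\sigma_* )$ induce the same isotropic Markov operators. (b) The heat kernel $p(t,x,y)$ associated with the triple $(d,\mu,\sigma)$ satisfies for all $x,y\in X$ and $t>0$ the identities $$p(t,x,y)=\int_0^{t/d_*(x,y)}N\!\left(x,\frac st\right)e^{-s}\,ds$$ and $$p(t,x,y)=t\int_0^{1/d_*(x,y)}N(x,\tau)\exp(-\tau t)\,d\tau .$$ Consequently, $p(t,x,y)$ is a finite continuous function of $(t,x,y)$ for all $t>0$ and $x\ne y$.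
   Context: Closed balls: $B_r(x)=\{y:d(x,y)\le r\}$. Averaging operators with respect to $d$: $\mathrm{Q}_rf(x)=\frac1{\mu(B_r(x))}\int_{B_r(x)}f\,d\mu$ for $r>0$, $\mathrm{Q}_0=\mathrm{id}$. A distance distribution function is a strictly increasing left-continuous function $\sigma:[0,\infty]\to[0,1]$ with $\sigma(0+)=0$, $\sigma(\infty)=1$. The function $\sigma_*$ is extended by $\sigma_*(0)=0$, $\sigma_*(\infty)=1$. The isotropic Markov operator associated with the triple $(d,\mu,\sigma)$ is $P=\int_{[0,\infty)}\mathrm{Q}_r\,d\sigma(r)$ (a bounded self-adjoint operator in $L^2(X,\mu)$ with spectrum in $[0,1]$). Its heat kernel is the integral kernel of $P^t$ with respect to $\mu$, given by $p(t,x,y)=\int_{[d(x,y),\infty)}\frac{d\sigma^t(r)}{\mu(B_r(x))}\in[0,\infty]$, where $\sigma^t(r)=(\sigma(r))^t$. Conventions: $d_*(x,x)=0$, $t/0=\infty$. Closed $d_*$-balls: $B^*_r(x)=\{y:d_*(x,y)\le r\}$. Spectral distribution function: $N(x,\tau)=\frac1{\mu(B^*_{1/\tau}(x))}$ for $\tau>0$, and $N(x,0)=1/\mu(X)$ (equal to $0$ if $\mu(X)=\infty$). *)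

theory Defs
  imports "HOL-Analysis.Analysis"
begin

section \<open>Ultra-metrics and Radon measures\<close>

definition ultra_metric :: "('a \<Rightarrow> 'a \<Rightarrow> real) \<Rightarrow> bool" where
  "ultra_metric d \<longleftrightarrow> Metric_space UNIV d \<and> (\<forall>x y z. d x y \<le> max (d x z) (d z y))"

text \<open>
  The metric is a parameter of the ball, because balls of two metrics on the same space are needed.
\<close>
definition closed_ball :: "('a \<Rightarrow> 'a \<Rightarrow> real) \<Rightarrow> 'a \<Rightarrow> real \<Rightarrow> 'a set" where
  "closed_ball d x r = {y. d x y \<le> r}"

definition radon_measure :: "'a::topological_space measure \<Rightarrow> bool" where
  "radon_measure M \<longleftrightarrow>
     sets M = sets borel \<and>
     (\<forall>K. compact K \<longrightarrow> emeasure M K < \<infinity>) \<and>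
     (\<forall>A\<in>sets borel. emeasure M A = (INF U\<in>{U. open U \<and> A \<subseteq> U}. emeasure M U)) \<and>
     (\<forall>U. open U \<longrightarrow> emeasure M U = (SUP K\<in>{K. compact K \<and> K \<subseteq> U}. emeasure M K))"

section \<open>Distance distribution functions\<close>

text \<open>
  The domain \<open>[0,\<infinity>]\<close> is the type \<^typ>\<open>ennreal\<close>. Left-continuity at \<open>0\<close> is void, since
  \<open>at_left 0\<close> is the trivial filter there; left-continuity at \<open>\<infinity>\<close> says that
  \<open>\<sigma> r\<close> tends to \<open>1\<close> as \<open>r\<close> tends to \<open>\<infinity>\<close>.
\<close>
definition distance_distribution :: "(ennreal \<Rightarrow> real) \<Rightarrow> bool" where
  "distance_distribution \<sigma> \<longleftrightarrow>
     (\<forall>r. 0 \<le> \<sigma> r \<and> \<sigma> r \<le> 1) \<and>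
     strict_mono \<sigma> \<and>
     (\<forall>r. (\<sigma> \<longlongrightarrow> \<sigma> r) (at_left r)) \<and>
     (\<sigma> \<longlongrightarrow> 0) (at_right 0) \<and>
     \<sigma> \<infinity> = 1"

text \<open>
  The Stieltjes measure \<open>d\<sigma>\<close> of a left-continuous function, so that
  \<open>d\<sigma>([a,b)) = \<sigma>(b) - \<sigma>(a)\<close> for \<open>0 \<le> a \<le> b\<close>; see \<open>emeasure_stieltjes\<close> below.
  Since \<^const>\<open>interval_measure\<close> expects a right-continuous function, it is applied to
  \<open>r \<mapsto> \<sigma>(r+)\<close>, extended by \<open>0\<close> to the negative half-line.
\<close>
definition stieltjes :: "(ennreal \<Rightarrow> real) \<Rightarrow> real measure" where
  "stieltjes \<sigma> =
     interval_measure (\<lambda>r. if r < 0 then 0 else (INF s\<in>{r<..}. \<sigma> (ennreal s)))"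

definition sigma_star :: "ennreal \<Rightarrow> real" where
  "sigma_star r = (if r = 0 then 0 else if r = \<infinity> then 1 else exp (- 1 / enn2real r))"

definition intrinsic_metric :: "('a \<Rightarrow> 'a \<Rightarrow> real) \<Rightarrow> (ennreal \<Rightarrow> real) \<Rightarrow> 'a \<Rightarrow> 'a \<Rightarrow> real" where
  "intrinsic_metric d \<sigma> x y = (if x = y then 0 else 1 / ln (1 / \<sigma> (ennreal (d x y))))"

section \<open>Isotropic Markov operators and heat kernels\<close>

definition averaging ::
  "('a \<Rightarrow> 'a \<Rightarrow> real) \<Rightarrow> 'a measure \<Rightarrow> real \<Rightarrow> ('a \<Rightarrow> real) \<Rightarrow> 'a \<Rightarrow> real" where
  "averaging d \<mu> r f x =
     (if r = 0 then f x
      else 1 / measure \<mu> (closed_ball d x r) * (LINT y:closed_ball d x r|\<mu>. f y))"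

definition isotropic_markov ::
  "('a \<Rightarrow> 'a \<Rightarrow> real) \<Rightarrow> 'a measure \<Rightarrow> (ennreal \<Rightarrow> real) \<Rightarrow> ('a \<Rightarrow> real) \<Rightarrow> 'a \<Rightarrow> real" where
  "isotropic_markov d \<mu> \<sigma> f x = (LINT r:{0..}|stieltjes \<sigma>. averaging d \<mu> r f x)"

definition square_integrable :: "'a measure \<Rightarrow> ('a \<Rightarrow> real) \<Rightarrow> bool" where
  "square_integrable \<mu> f \<longleftrightarrow> f \<in> borel_measurable \<mu> \<and> integrable \<mu> (\<lambda>x. (f x)\<^sup>2)"

text \<open>
  Equality as operators on \<open>L\<^sup>2(\<mu>)\<close>, whose elements are classes of functions modulo
  \<open>\<mu>\<close>-almost everywhere equality.
\<close>
definition same_L2_operator ::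
  "'a measure \<Rightarrow> (('a \<Rightarrow> real) \<Rightarrow> 'a \<Rightarrow> real) \<Rightarrow> (('a \<Rightarrow> real) \<Rightarrow> 'a \<Rightarrow> real) \<Rightarrow> bool" where
  "same_L2_operator \<mu> P P' \<longleftrightarrow>
     (\<forall>f. square_integrable \<mu> f \<longrightarrow> (AE x in \<mu>. P f x = P' f x))"

text \<open>The pointwise version of the integral kernel of \<open>P\<^sup>t\<close>, with values in \<open>[0,\<infinity>]\<close>.\<close>
definition heat_kernel ::
  "('a \<Rightarrow> 'a \<Rightarrow> real) \<Rightarrow> 'a measure \<Rightarrow> (ennreal \<Rightarrow> real) \<Rightarrow> real \<Rightarrow> 'a \<Rightarrow> 'a \<Rightarrow> ennreal" where
  "heat_kernel d \<mu> \<sigma> t x y =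
     (\<integral>\<^sup>+ r\<in>{d x y..}. 1 / emeasure \<mu> (closed_ball d x r) \<partial>stieltjes (\<lambda>r. \<sigma> r powr t))"

text \<open>The metric argument is meant to be the intrinsic one; \<open>1 / \<infinity> = 0\<close> in \<^typ>\<open>ennreal\<close>.\<close>
definition spectral_distribution ::
  "('a \<Rightarrow> 'a \<Rightarrow> real) \<Rightarrow> 'a measure \<Rightarrow> 'a \<Rightarrow> real \<Rightarrow> ennreal" where
  "spectral_distribution ds \<mu> x \<tau> =
     (if \<tau> = 0 then 1 / emeasure \<mu> (space \<mu>) else 1 / emeasure \<mu> (closed_ball ds x (1 / \<tau>)))"

section \<open>Consistency of the definitions\<close>

lemma distance_distribution_0:
  assumes "distance_distribution \<sigma>"
  shows "\<sigma> 0 = 0"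
proof -
  have mono: "\<sigma> 0 \<le> \<sigma> r" for r
    using assms by (auto simp: distance_distribution_def intro: monoD[OF strict_mono_mono, of \<sigma>])
  have "\<exists>y>0. y < b" if "0 < b" for b :: ennreal
    using dense[OF that] by blast
  then have "at_right (0::ennreal) \<noteq> bot"
    unfolding trivial_limit_def eventually_at_right[OF zero_less_one] by blast
  then have "\<sigma> 0 \<le> 0"
    using assms mono by (intro tendsto_lowerbound[of \<sigma> 0 "at_right 0"]) (auto simp: distance_distribution_def)
  then show ?thesis using assms by (simp add: distance_distribution_def antisym)
qed

lemma emeasure_stieltjes:
  assumes \<sigma>: "distance_distribution \<sigma>" and ab: "0 \<le> a" "a \<le> b"
  shows "emeasure (stieltjes \<sigma>) {a..<b} = ennreal (\<sigma> (ennreal b) - \<sigma> (ennreal a))"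
proof -
  define F where "F r = (if r < 0 then 0 else (INF s\<in>{r<..}. \<sigma> (ennreal s)))" for r :: real
  have M: "stieltjes \<sigma> = interval_measure F"
    by (simp add: stieltjes_def F_def[abs_def])
  have pos: "0 \<le> \<sigma> r" for r using \<sigma> by (simp add: distance_distribution_def)
  have mono: "r \<le> s \<Longrightarrow> \<sigma> r \<le> \<sigma> s" for r s
    using \<sigma> by (auto simp: distance_distribution_def intro: monoD[OF strict_mono_mono, of \<sigma>])
  have bdd: "bdd_below ((\<lambda>s. \<sigma> (ennreal s)) ` A)" for A
    using pos by (intro bdd_belowI2)
  have F_le: "F r \<le> \<sigma> (ennreal s)" if "r < s" for r s
    using that bdd pos by (auto simp: F_def intro!: cINF_lower)
  have F_ge: "\<sigma> (ennreal r) \<le> F r" if "0 \<le> r" for r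
    using that by (auto simp: F_def intro!: cINF_greatest mono ennreal_leI)
  have F0: "F r = 0" if "r < 0" for r using that by (simp add: F_def)
  have Fpos: "0 \<le> F r" for r
    using F_ge[of r] F0[of r] pos[of "ennreal r"] by (cases "r < 0") auto
  have Fmono: "F r \<le> F s" if "r \<le> s" for r s
  proof (cases "r < 0 \<or> r = s")
    case True then show ?thesis using F0 Fpos by auto
  next
    case False then show ?thesis using F_le[of r s] F_ge[of s] that by auto
  qed
  have Fcont: "continuous (at_right r) F" for r
    unfolding continuous_within
  proof (rule order_tendstoI)
    fix l assume "l < F r"
    then show "eventually (\<lambda>s. l < F s) (at_right r)"
      unfolding eventually_at_right_field
      using Fmono by (intro exI[of _ "r + 1"]) (auto intro: less_le_trans less_imp_le)
  next
    fix u assume u: "F r < u"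
    have "\<exists>s>r. \<forall>s'<s. F s' < u"
    proof (cases "r < 0")
      case True
      then show ?thesis using u F0 by (intro exI[of _ 0]) auto
    next
      case False
      then have "\<exists>s\<in>{r<..}. \<sigma> (ennreal s) < u"
        using u cINF_less_iff[of "{r<..}" "\<lambda>s. \<sigma> (ennreal s)" u] bdd by (auto simp: F_def)
      then show ?thesis using F_le by (meson greaterThan_iff le_less_trans)
    qed
    then show "eventually (\<lambda>s. F s < u) (at_right r)"
      unfolding eventually_at_right_field by blast
  qed
  have Ioc: "emeasure (stieltjes \<sigma>) {x<..y} = ennreal (F y - F x)" if "x \<le> y" for x y
    unfolding M using emeasure_interval_measure_Ioc[OF that Fmono Fcont] by simp
  have Ioo: "emeasure (stieltjes \<sigma>) {-1<..<c} = ennreal (\<sigma> (ennreal c))" if c: "0 \<le> c" for c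
  proof (cases "c = 0")
    case True
    have "emeasure (stieltjes \<sigma>) {-1<..<0} \<le> emeasure (stieltjes \<sigma>) {-1<..0}"
      by (intro emeasure_mono) (auto simp: M)
    also have "\<dots> = ennreal (F 0)" using Ioc[of "-1" 0] F0 by simp
    also have "F 0 = 0"
    proof -
      have "F 0 \<le> 0"
      proof (rule tendsto_lowerbound)
        show "((\<lambda>n. \<sigma> (ennreal (1 / real (Suc n)))) \<longlongrightarrow> 0) sequentially"
        proof (rule filterlim_compose[where g = \<sigma>])
          show "(\<sigma> \<longlongrightarrow> 0) (at_right 0)" using \<sigma> by (simp add: distance_distribution_def)
          have "(\<lambda>n. ennreal (1 / real (Suc n))) \<longlonglongrightarrow> ennreal 0"
            by (intro tendsto_ennrealI LIMSEQ_Suc lim_1_over_n)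
          then show "filterlim (\<lambda>n. ennreal (1 / real (Suc n))) (at_right 0) sequentially"
            by (auto simp: filterlim_at)
        qed
        show "eventually (\<lambda>n. F 0 \<le> \<sigma> (ennreal (1 / real (Suc n)))) sequentially"
          by (intro always_eventually allI F_le) simp
      qed simp
      then show ?thesis using Fpos[of 0] by simp
    qed
    finally show ?thesis using True distance_distribution_0[OF \<sigma>] by simp
  next
    case False
    with c have c: "0 < c" by simp
    define X where "X n = c - c / real (Suc n)" for n :: nat
    have X: "0 \<le> X n" "X n < c" for n using c by (auto simp: X_def field_simps)
    have "X \<longlonglongrightarrow> c - c * 0"
      unfolding X_def using tendsto_mult_left[OF LIMSEQ_Suc[OF lim_1_over_n], of c]
      by (intro tendsto_diff tendsto_const) auto
    then have Xlim: "X \<longlonglongrightarrow> c" by simp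
    have "incseq X"
      unfolding X_def using c by (auto simp: incseq_def intro!: divide_left_mono)
    have un: "(\<Union>n. {-1<..X n}) = {-1<..<c}"
    proof safe
      fix n x assume "x \<in> {-1<..X n}" then show "x \<in> {-1<..<c}" using X(2)[of n] by auto
    next
      fix x assume x: "x \<in> {-1<..<c}"
      then obtain n where "x < X n"
        using order_tendstoD(1)[OF Xlim, of x] by (auto simp: eventually_sequentially)
      with x show "x \<in> (\<Union>n. {-1<..X n})" by (auto intro: less_imp_le)
    qed
    have "(\<lambda>n. emeasure (stieltjes \<sigma>) {-1<..X n}) \<longlonglongrightarrow> emeasure (stieltjes \<sigma>) (\<Union>n. {-1<..X n})"
    proof (rule Lim_emeasure_incseq)
      show "incseq (\<lambda>n. {-1<..X n})"
        using \<open>incseq X\<close> by (fastforce simp: incseq_def intro: order_trans)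
    qed (auto simp: M)
    moreover have "emeasure (stieltjes \<sigma>) {-1<..X n} = ennreal (F (X n))" for n
      using Ioc[of "-1" "X n"] X(1)[of n] F0[of "-1"] by simp
    ultimately have 1: "(\<lambda>n. ennreal (F (X n))) \<longlonglongrightarrow> emeasure (stieltjes \<sigma>) {-1<..<c}"
      by (simp add: un)
    have "(\<lambda>n. \<sigma> (ennreal (X n))) \<longlonglongrightarrow> \<sigma> (ennreal c)"
    proof (rule filterlim_compose[where g = \<sigma>])
      show "(\<sigma> \<longlongrightarrow> \<sigma> (ennreal c)) (at_left (ennreal c))"
        using \<sigma> by (simp add: distance_distribution_def)
      show "filterlim (\<lambda>n. ennreal (X n)) (at_left (ennreal c)) sequentially"
        using tendsto_ennrealI[OF Xlim] X by (auto simp: filterlim_at ennreal_less_iff less_imp_neq)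
    qed
    then have "(\<lambda>n. F (X n)) \<longlonglongrightarrow> \<sigma> (ennreal c)"
      by (rule tendsto_sandwich[rotated 2, OF _ tendsto_const]) (auto intro!: always_eventually F_ge F_le X)
    from LIMSEQ_unique[OF 1 tendsto_ennrealI[OF this]] show ?thesis .
  qed
  have "{a..<b} = {-1<..<b} - {-1<..<a}" using ab by auto
  also have "emeasure (stieltjes \<sigma>) \<dots> = ennreal (\<sigma> (ennreal b)) - ennreal (\<sigma> (ennreal a))"
    using ab Ioo[of a] Ioo[of b] by (subst emeasure_Diff) (auto simp: M)
  also have "\<dots> = ennreal (\<sigma> (ennreal b) - \<sigma> (ennreal a))"
    using pos by (simp add: ennreal_minus)
  finally show ?thesis .
qed

lemma distance_distribution_pos:
  assumes "distance_distribution \<sigma>" "0 < r" "r < \<infinity>"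
  shows "0 < \<sigma> r" "\<sigma> r < 1"
proof -
  have "strict_mono \<sigma>" "\<sigma> \<infinity> = 1" using assms by (auto simp: distance_distribution_def)
  then show "0 < \<sigma> r" "\<sigma> r < 1"
    using strict_monoD[of \<sigma> 0 r] strict_monoD[of \<sigma> r \<infinity>] assms distance_distribution_0[of \<sigma>] by auto
qed

lemma ultra_metric_intrinsic_metric:
  assumes d: "ultra_metric d" and \<sigma>: "distance_distribution \<sigma>"
  shows "ultra_metric (intrinsic_metric d \<sigma>)"
proof -
  interpret Metric_space UNIV d using d by (simp add: ultra_metric_def)
  let ?g = "\<lambda>r. if r = 0 then 0 else 1 / ln (1 / \<sigma> (ennreal r))"
  have eq: "intrinsic_metric d \<sigma> x y = ?g (d x y)" for x y
    by (simp add: intrinsic_metric_def)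
  have ln_pos: "0 < ln (1 / \<sigma> (ennreal r))" if "0 < r" for r
    using distance_distribution_pos[OF \<sigma>, of "ennreal r"] that by (simp add: ennreal_zero_less_divide)
  have g_pos: "0 < ?g r" if "0 < r" for r using ln_pos[OF that] that by simp
  have g_mono: "?g r \<le> ?g s" if "0 \<le> r" "r \<le> s" for r s
  proof (cases "r = 0")
    case True then show ?thesis using g_pos[of s] that by (cases "s = 0") (auto simp: less_imp_le)
  next
    case False
    with that have rs: "0 < r" "0 < s" by auto
    have le: "\<sigma> (ennreal r) \<le> \<sigma> (ennreal s)"
      by (rule monoD[OF strict_mono_mono, of \<sigma>, OF _ ennreal_leI[OF that(2)]])
         (use \<sigma> in \<open>simp add: distance_distribution_def\<close>)
    have pos: "0 < \<sigma> (ennreal r)" "0 < \<sigma> (ennreal s)"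
      using distance_distribution_pos(1)[OF \<sigma>] rs by (simp_all add: ennreal_less_top)
    have "ln (1 / \<sigma> (ennreal s)) \<le> ln (1 / \<sigma> (ennreal r))"
      using pos by (intro ln_mono frac_le le) simp_all
    then have "1 / ln (1 / \<sigma> (ennreal r)) \<le> 1 / ln (1 / \<sigma> (ennreal s))"
      by (intro frac_le ln_pos rs) simp_all
    then show ?thesis using rs by simp
  qed
  have ultra: "intrinsic_metric d \<sigma> x y \<le> max (intrinsic_metric d \<sigma> x z) (intrinsic_metric d \<sigma> z y)" for x y z
  proof -
    have "d x y \<le> d x z \<or> d x y \<le> d z y"
      using d by (auto simp: ultra_metric_def le_max_iff_disj)
    then show ?thesis unfolding eq le_max_iff_disj using g_mono[OF nonneg] by blast
  qed
  have nn: "0 \<le> intrinsic_metric d \<sigma> x y" for x y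
    unfolding eq using g_mono[of 0 "d x y"] by simp
  have "Metric_space UNIV (intrinsic_metric d \<sigma>)"
  proof
    fix x y z :: 'a
    show "0 \<le> intrinsic_metric d \<sigma> x y" by (rule nn)
    show "intrinsic_metric d \<sigma> x y = intrinsic_metric d \<sigma> y x" by (simp add: eq commute)
    show "(intrinsic_metric d \<sigma> x y = 0) = (x = y)"
      using g_pos[of "d x y"] nonneg[of x y] unfolding eq by (auto simp: less_le)
    show "intrinsic_metric d \<sigma> x z \<le> intrinsic_metric d \<sigma> x y + intrinsic_metric d \<sigma> y z"
      using ultra[of x z y] nn[of x y] nn[of y z] by linarith
  qed
  then show ?thesis using ultra by (auto simp: ultra_metric_def)
qed

end

theory Submission
  imports Defs "HOL-Real_Asymp.Real_Asymp"
begin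

text \<open>
  Under the substitution \<open>\<sigma>(r) = exp (-\<tau>)\<close>, the measure \<open>d\<sigma>\<^sup>t(r)\<close> becomes the exponential
  distribution \<open>t exp (-\<tau> t) d\<tau>\<close>, and the ball of radius \<open>r\<close> around \<open>x\<close> becomes
  \<open>{y. \<sigma> (d x y) \<le> exp (-\<tau>)}\<close>, which is the \<open>d\<^sub>*\<close>-ball of radius \<open>1 / \<tau>\<close>. So both triples
  average over the same balls with the same weights, and the heat kernel is a Laplace transform of
  \<open>N(x, \<cdot>)\<close>. By the ultra-metric inequality the heat kernel is locally constant in \<open>(x, y)\<close> off the
  diagonal, so its continuity reduces to dominated convergence in \<open>t\<close>.
\<close>

section \<open>Distance distribution functions, their powers, and \<open>sigma_star\<close>\<close>

lemma distance_distribution_mono: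
  assumes "distance_distribution \<sigma>" "r \<le> s"
  shows "\<sigma> r \<le> \<sigma> s"
  using assms by (auto simp: distance_distribution_def intro: monoD[OF strict_mono_mono, of \<sigma>])

text \<open>Left-continuity carries the bound to the endpoint. The condition \<open>0 < s\<close>
  makes \<open>at_left s\<close> a proper filter. The case of infinite \<open>s\<close> shows that
  the radii with \<open>\<sigma>\<close> at most \<open>exp (- \<tau>)\<close> are bounded, and the
  case of their supremum shows that it is attained.\<close>

lemma distance_distribution_le_left_limit:
  assumes \<sigma>: "distance_distribution \<sigma>" and "0 < s" and le: "\<And>r. r < s \<Longrightarrow> \<sigma> r \<le> u"
  shows "\<sigma> s \<le> u"
proof (rule tendsto_upperbound)
  show "(\<sigma> \<longlongrightarrow> \<sigma> s) (at_left s)"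
    using \<sigma> by (simp add: distance_distribution_def)
  show "eventually (\<lambda>r. \<sigma> r \<le> u) (at_left s)"
    using le by (auto simp: eventually_at_filter)
  have "\<exists>y<s. b < y" if "b < s" for b
    using dense[OF that] by blast
  then show "at_left s \<noteq> bot"
    unfolding trivial_limit_def eventually_at_left[OF \<open>0 < s\<close>] by blast
qed

text \<open>The power map is continuous and strictly increasing on the unit interval and fixes 0 and
  1. Hence \<open>emeasure_stieltjes\<close> applies to the measure that defines the heat kernel at
  time \<open>t\<close>.\<close>

lemma distance_distribution_powr:
  assumes \<sigma>: "distance_distribution \<sigma>" and t: "0 < t"
  shows "distance_distribution (\<lambda>r. \<sigma> r powr t)"
proof -
  have nn: "0 \<le> \<sigma> r" "\<sigma> r \<le> 1" for r
    using \<sigma> by (simp_all add: distance_distribution_def)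
  have lim: "((\<lambda>r. \<sigma> r powr t) \<longlongrightarrow> c powr t) F" if "(\<sigma> \<longlongrightarrow> c) F" for c F
    using that t nn by (intro tendsto_powr') auto
  have "strict_mono (\<lambda>r. \<sigma> r powr t)"
    using \<sigma> t nn by (auto simp: distance_distribution_def strict_mono_def intro!: powr_less_mono2)
  moreover have "((\<lambda>r. \<sigma> r powr t) \<longlongrightarrow> 0) (at_right 0)"
    using lim[of 0 "at_right 0"] \<sigma> by (simp add: distance_distribution_def)
  moreover have "((\<lambda>r. \<sigma> r powr t) \<longlongrightarrow> \<sigma> r powr t) (at_left r)" for r
    using lim[of "\<sigma> r" "at_left r"] \<sigma> by (simp add: distance_distribution_def)
  ultimately show ?thesis
    using \<sigma> nn t by (auto simp: distance_distribution_def intro: powr_le1)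
qed

lemma sigma_star_ennreal: "0 < r \<Longrightarrow> sigma_star (ennreal r) = exp (- 1 / r)"
  by (simp add: sigma_star_def)

lemma strict_mono_sigma_star: "strict_mono sigma_star"
proof (rule strict_monoI)
  fix r s :: ennreal
  assume "r < s"
  then show "sigma_star r < sigma_star s"
    by (cases r; cases s)
       (auto simp: sigma_star_def ennreal_less_iff ennreal_eq_0_iff field_simps)
qed

text \<open>This admits \<open>sigma_star\<close> to every result about a general
  \<open>\<sigma>\<close>, so that both triples can be treated by the same argument.\<close>

lemma distance_distribution_sigma_star: "distance_distribution sigma_star"
proof -
  note mono = monoD[OF strict_mono_mono[OF strict_mono_sigma_star]]
  have bounds: "0 \<le> sigma_star r" "sigma_star r \<le> 1" for r
    by (auto simp: sigma_star_def)
  have lim_0: "(sigma_star \<longlongrightarrow> 0) (at_right 0)"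
  proof (rule order_tendstoI)
    fix u :: real assume u: "0 < u"
    have "((\<lambda>b::real. exp (- 1 / b)) \<longlongrightarrow> 0) (at_right 0)"
      by real_asymp
    then have "eventually (\<lambda>b::real. exp (- 1 / b) < u) (at_right 0)"
      using u by (rule order_tendstoD)
    then have "eventually (\<lambda>b::real. exp (- 1 / b) < u \<and> 0 < b) (at_right 0)"
      using eventually_at_right_less by (rule eventually_conj)
    then obtain b :: real where b: "exp (- 1 / b) < u" "0 < b"
      using eventually_happens[of _ "at_right (0::real)"] by fastforce
    \<comment> \<open>By monotonicity the value at the single radius \<open>b\<close> controls the
      whole neighbourhood below it; the limit at infinity is handled in the same way.\<close>
    have "sigma_star r < u" if "r < ennreal b" for r
      using b le_less_trans[OF mono[OF less_imp_le[OF that]]] sigma_star_ennreal[of b] by simp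
    then show "eventually (\<lambda>r. sigma_star r < u) (at_right 0)"
      unfolding eventually_at_right[OF zero_less_one]
      using b by (intro exI[of _ "ennreal b"]) auto
  next
    fix l :: real assume "l < 0"
    then have "l < sigma_star r" for r
      using bounds(1)[of r] by simp
    then show "eventually (\<lambda>r. l < sigma_star r) (at_right 0)"
      by simp
  qed
  have lim_top: "(sigma_star \<longlongrightarrow> 1) (at_left \<infinity>)"
  proof (rule order_tendstoI)
    fix u :: real assume u: "u < 1"
    have "((\<lambda>b::real. exp (- 1 / b)) \<longlongrightarrow> 1) at_top"
      by real_asymp
    then have "eventually (\<lambda>b::real. u < exp (- 1 / b)) at_top"
      using u by (rule order_tendstoD)
    then have "eventually (\<lambda>b::real. u < exp (- 1 / b) \<and> 0 < b) at_top"
      using eventually_gt_at_top by (rule eventually_conj)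
    then obtain b :: real where b: "u < exp (- 1 / b)" "0 < b"
      using eventually_happens[of _ "at_top :: real filter"] by fastforce
    have "u < sigma_star r" if "ennreal b < r" for r
      using b less_le_trans[OF _ mono[OF less_imp_le[OF that]]] sigma_star_ennreal[of b] by simp
    then show "eventually (\<lambda>r. u < sigma_star r) (at_left \<infinity>)"
      unfolding eventually_at_left[OF ennreal_zero_less_top, folded infinity_ennreal_def]
      by (intro exI[of _ "ennreal b"]) auto
  next
    fix l :: real assume "1 < l"
    then have "sigma_star r < l" for r
      using bounds(2)[of r] by simp
    then show "eventually (\<lambda>r. sigma_star r < l) (at_left \<infinity>)"
      by simp
  qed
  have "(sigma_star \<longlongrightarrow> sigma_star r) (at_left r)" for r
  proof (cases "r = 0 \<or> r = \<infinity>")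
    case True
    \<comment> \<open>Left-continuity is vacuous at 0, and at infinity it is
      \<open>lim_top\<close>.\<close>
    have "at_left (0::ennreal) = bot"
      by (simp add: at_within_def lessThan_def bot_eq_principal_empty[symmetric] flip: bot_ennreal)
    with True show ?thesis
      using lim_top by (auto simp: sigma_star_def)
  next
    case False
    then obtain a where a: "r = ennreal a" "0 < a"
      by (cases r) (auto simp: ennreal_eq_0_iff)
    have "((\<lambda>q. exp (- 1 / enn2real q)) \<longlongrightarrow> exp (- 1 / a)) (at_left r)"
      using a by (auto intro!: tendsto_intros tendsto_enn2real)
    moreover have "0 < r"
      using a by simp
    then have "eventually (\<lambda>q. exp (- 1 / enn2real q) = sigma_star q) (at_left r)"
      unfolding eventually_at_left[OF \<open>0 < r\<close>]
      by (intro exI[of _ 0]) (auto simp: sigma_star_def)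
    ultimately show ?thesis
      using a by (auto simp: sigma_star_ennreal intro: Lim_transform_eventually)
  qed
  then show ?thesis
    using bounds strict_mono_sigma_star lim_0 by (simp add: distance_distribution_def) (simp add: sigma_star_def)
qed

section \<open>The radius as a function of an exponential variable\<close>

text \<open>
  If \<open>\<tau>\<close> is exponentially distributed with rate \<open>t\<close>, then \<open>exp_radius \<sigma> \<tau>\<close> has distribution
  \<open>d\<sigma>\<^sup>t\<close>, with the same map for all \<open>t\<close>.
\<close>
definition exp_radius :: "(ennreal \<Rightarrow> real) \<Rightarrow> real \<Rightarrow> real" where
  "exp_radius \<sigma> \<tau> = (if 0 < \<tau> then Sup {r. 0 \<le> r \<and> \<sigma> (ennreal r) \<le> exp (- \<tau>)} else 0)"

text \<open>The radii with \<open>\<sigma>\<close> at most \<open>exp (- \<tau>)\<close> form a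
  closed interval starting at 0: it contains a positive radius since
  \<open>\<sigma>(0+) = 0\<close>, is bounded by left-continuity at infinity, and contains its
  supremum by left-continuity there. The resulting equivalence is the form in which
  \<open>exp_radius\<close> is used later.\<close>

lemma
  assumes \<sigma>: "distance_distribution \<sigma>" and \<tau>: "0 < \<tau>"
  shows exp_radius_pos: "0 < exp_radius \<sigma> \<tau>"
    and le_exp_radius_iff: "\<And>r. 0 \<le> r \<Longrightarrow> r \<le> exp_radius \<sigma> \<tau> \<longleftrightarrow> \<sigma> (ennreal r) \<le> exp (- \<tau>)"
proof -
  define A where "A = {r. 0 \<le> r \<and> \<sigma> (ennreal r) \<le> exp (- \<tau>)}"
  have S: "exp_radius \<sigma> \<tau> = Sup A"
    using \<tau> by (simp add: exp_radius_def A_def)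
  have "0 \<in> A"
    using distance_distribution_0[OF \<sigma>] by (simp add: A_def)
  have "\<exists>R\<ge>0. exp (- \<tau>) < \<sigma> (ennreal R)"
  proof (rule ccontr)
    assume *: "\<not> ?thesis"
    have le: "\<sigma> r \<le> exp (- \<tau>)" if "r < \<infinity>" for r
      using * that by (cases r) (auto simp: not_less)
    have "\<sigma> \<infinity> \<le> exp (- \<tau>)"
      by (rule distance_distribution_le_left_limit[OF \<sigma> _ le]) simp_all
    then show False
      using \<sigma> \<tau> by (simp add: distance_distribution_def)
  qed
  then obtain R where R: "0 \<le> R" "exp (- \<tau>) < \<sigma> (ennreal R)"
    by blast
  have "r \<le> R" if "r \<in> A" for r
  proof (rule ccontr)
    assume "\<not> r \<le> R"
    then have "\<sigma> (ennreal R) \<le> \<sigma> (ennreal r)"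
      by (intro distance_distribution_mono[OF \<sigma>] ennreal_leI) simp
    then show False
      using R that by (simp add: A_def)
  qed
  then have bdd: "bdd_above A"
    by (auto simp: bdd_above_def)
  \<comment> \<open>The limit 0 at \<open>0+\<close> supplies a positive member \<open>r'\<close> of
    \<open>A\<close>.\<close>
  have "eventually (\<lambda>r. \<sigma> r < exp (- \<tau>)) (at_right 0)"
    using \<sigma> by (intro order_tendstoD) (auto simp: distance_distribution_def)
  then obtain b where b: "0 < b" "\<And>r. 0 < r \<Longrightarrow> r < b \<Longrightarrow> \<sigma> r < exp (- \<tau>)"
    unfolding eventually_at_right[OF zero_less_one] by blast
  obtain r where r: "0 < r" "r < b"
    using dense[OF b(1)] by blast
  then obtain r' where "r = ennreal r'" "0 < r'"
    by (cases r) auto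
  with b(2)[OF r] have "r' \<in> A"
    by (simp add: A_def)
  then show pos: "0 < exp_radius \<sigma> \<tau>"
    using cSup_upper[OF _ bdd, of r'] \<open>0 < r'\<close> by (simp add: S)
  have "\<sigma> (ennreal (Sup A)) \<le> exp (- \<tau>)"
  proof (rule distance_distribution_le_left_limit[OF \<sigma>])
    fix r assume "r < ennreal (Sup A)"
    then obtain q where q: "r = ennreal q" "0 \<le> q" "q < Sup A"
      by (cases r) (auto simp: ennreal_less_iff)
    then obtain a where "a \<in> A" "q < a"
      using less_cSup_iff[OF _ bdd] \<open>0 \<in> A\<close> by blast
    then have "\<sigma> r \<le> \<sigma> (ennreal a)"
      using q by (intro distance_distribution_mono[OF \<sigma>]) (simp add: ennreal_leI)
    with \<open>a \<in> A\<close> show "\<sigma> r \<le> exp (- \<tau>)"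
      by (simp add: A_def)
  qed (use pos in \<open>simp add: S\<close>)
  note le_Sup = this
  fix r :: real assume r: "0 \<le> r"
  show "r \<le> exp_radius \<sigma> \<tau> \<longleftrightarrow> \<sigma> (ennreal r) \<le> exp (- \<tau>)"
  proof
    assume "r \<le> exp_radius \<sigma> \<tau>"
    then have "\<sigma> (ennreal r) \<le> \<sigma> (ennreal (Sup A))"
      unfolding S by (intro distance_distribution_mono[OF \<sigma>] ennreal_leI)
    with le_Sup show "\<sigma> (ennreal r) \<le> exp (- \<tau>)"
      by simp
  next
    assume "\<sigma> (ennreal r) \<le> exp (- \<tau>)"
    with r show "r \<le> exp_radius \<sigma> \<tau>"
      unfolding S by (intro cSup_upper bdd) (simp add: A_def)
  qed
qed

lemma exp_radius_nonneg: "distance_distribution \<sigma> \<Longrightarrow> 0 \<le> exp_radius \<sigma> \<tau>"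
  using exp_radius_pos[of \<sigma> \<tau>] by (cases "0 < \<tau>") (auto simp: exp_radius_def)

text \<open>For positive \<open>r\<close>, \<open>exp (- 1 / r)\<close> is at most
  \<open>exp (- \<tau>)\<close> exactly when \<open>r\<close> is at most \<open>1 / \<tau>\<close>;
  two positive reals with the same positive lower bounds are equal.\<close>

lemma exp_radius_sigma_star:
  assumes \<tau>: "0 < \<tau>"
  shows "exp_radius sigma_star \<tau> = 1 / \<tau>"
proof -
  have *: "r \<le> exp_radius sigma_star \<tau> \<longleftrightarrow> r \<le> 1 / \<tau>" if "0 < r" for r
    using le_exp_radius_iff[OF distance_distribution_sigma_star \<tau>, of r] that \<tau>
    by (simp add: sigma_star_ennreal field_simps)
  show ?thesis
    using *[of "exp_radius sigma_star \<tau>"] *[of "1 / \<tau>"] \<tau>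
      exp_radius_pos[OF distance_distribution_sigma_star \<tau>] by simp
qed

text \<open>For \<open>b > 0\<close> the sublevel set is cut out by a strict inequality on
  \<open>exp (- \<tau>)\<close>, together with all \<open>\<tau> \<le> 0\<close>, where the value is
  the default 0.\<close>

lemma measurable_exp_radius [measurable]:
  assumes \<sigma>: "distance_distribution \<sigma>"
  shows "exp_radius \<sigma> \<in> borel_measurable borel"
proof (rule borel_measurableI_less)
  fix b :: real
  have "{\<tau> \<in> space borel. exp_radius \<sigma> \<tau> < b} =
    (if b \<le> 0 then {} else {\<tau>. 0 < \<tau> \<longrightarrow> exp (- \<tau>) < \<sigma> (ennreal b)})"
  proof (cases "b \<le> 0")
    case True
    then show ?thesis
      using order_trans[OF True exp_radius_nonneg[OF \<sigma>]] by (auto simp: not_less[symmetric])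
  next
    case False
    have "exp_radius \<sigma> \<tau> < b \<longleftrightarrow> (0 < \<tau> \<longrightarrow> exp (- \<tau>) < \<sigma> (ennreal b))" for \<tau>
    proof (cases "0 < \<tau>")
      case True
      then show ?thesis
        using le_exp_radius_iff[OF \<sigma>, of \<tau> b] False by auto
    qed (use False in \<open>simp add: exp_radius_def\<close>)
    with False show ?thesis by simp
  qed
  then show "{\<tau> \<in> space borel. exp_radius \<sigma> \<tau> < b} \<in> sets borel"
    by simp
qed

section \<open>Transport of the exponential distribution to the Stieltjes measure\<close>

text \<open>It vanishes outside \<open>0 < \<tau>\<close>, so almost-everywhere statements for it
  need checking only where \<open>exp_radius\<close> is characterised.\<close>

definition exp_density :: "real \<Rightarrow> real \<Rightarrow> real" where
  "exp_density t \<tau> = (if 0 < \<tau> then t * exp (- \<tau> * t) else 0)"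

lemma measurable_exp_density [measurable]: "exp_density t \<in> borel_measurable borel"
  unfolding exp_density_def by measurable

lemma emeasure_exp_density_greaterThan:
  assumes t: "0 < t" and L: "0 \<le> L"
  shows "emeasure (density lborel (exp_density t)) {L<..} = ennreal (exp (- L * t))"
proof -
  \<comment> \<open>The point \<open>L\<close> is null, so the half-line may be closed to suit the
    fundamental theorem of calculus.\<close>
  have "emeasure (density lborel (exp_density t)) {L<..} =
      (\<integral>\<^sup>+\<tau>. ennreal (t * exp (- \<tau> * t)) * indicator {L..} \<tau> \<partial>lborel)"
  proof (subst emeasure_density)
    show "(\<integral>\<^sup>+\<tau>. ennreal (exp_density t \<tau>) * indicator {L<..} \<tau> \<partial>lborel) =
        (\<integral>\<^sup>+\<tau>. ennreal (t * exp (- \<tau> * t)) * indicator {L..} \<tau> \<partial>lborel)"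
    proof (rule nn_integral_cong_AE)
    show "AE \<tau> in lborel. ennreal (exp_density t \<tau>) * indicator {L<..} \<tau> =
        ennreal (t * exp (- \<tau> * t)) * indicator {L..} \<tau>"
      using AE_lborel_singleton[of L]
      by eventually_elim (use L in \<open>auto simp: exp_density_def indicator_def\<close>)
    qed
  qed simp_all
  also have "\<dots> = ennreal (0 - (- exp (- L * t)))"
  proof (rule nn_integral_FTC_atLeast)
    show "((\<lambda>\<tau>. - exp (- \<tau> * t)) \<longlongrightarrow> 0) at_top"
      using t by real_asymp
  qed (use t in \<open>auto intro!: derivative_eq_intros\<close>)
  finally show ?thesis by simp
qed

lemma sets_stieltjes [measurable_cong]: "sets (stieltjes \<sigma>) = sets borel"
  by (simp add: stieltjes_def)

text \<open>Both measures give \<open>{..<b}\<close> the mass \<open>\<sigma>(b)\<close> to the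
  power \<open>t\<close>. For the image measure with \<open>b > 0\<close> this is the exponential
  tail beyond \<open>- ln \<sigma>(b)\<close>, because \<open>exp_radius \<sigma> \<tau> < b\<close>
  means that \<open>\<tau>\<close> exceeds that number.\<close>

lemma stieltjes_powr_eq_distr:
  assumes \<sigma>: "distance_distribution \<sigma>" and t: "0 < t"
  shows "density (stieltjes (\<lambda>r. \<sigma> r powr t)) (indicator {0..}) =
    distr (density lborel (exp_density t)) borel (exp_radius \<sigma>)" (is "?M = ?N")
proof -
  have \<sigma>t: "distance_distribution (\<lambda>r. \<sigma> r powr t)"
    by (rule distance_distribution_powr[OF \<sigma> t])
  note [measurable] = measurable_exp_radius[OF \<sigma>]
  have M: "emeasure ?M {..<b} = ennreal (\<sigma> (ennreal b) powr t)" for b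
  proof -
    have "emeasure ?M {..<b} = emeasure (stieltjes (\<lambda>r. \<sigma> r powr t)) ({0..} \<inter> {..<b})"
      by (subst emeasure_density) (auto simp flip: indicator_inter_arith)
    \<comment> \<open>Taking \<open>max 0 b\<close> covers negative \<open>b\<close> too: then
      \<open>ennreal b = 0\<close>, and \<open>\<sigma>\<close> vanishes at 0.\<close>
    also have "{0..} \<inter> {..<b} = {0..<max 0 b}"
      by auto
    also have "emeasure (stieltjes (\<lambda>r. \<sigma> r powr t)) \<dots> = ennreal (\<sigma> (ennreal b) powr t)"
      using emeasure_stieltjes[OF \<sigma>t, of 0 "max 0 b"] distance_distribution_0[OF \<sigma>]
      by (simp add: max_def ennreal_neg split: if_splits)
    finally show ?thesis .
  qed
  have N: "emeasure ?N {..<b} = ennreal (\<sigma> (ennreal b) powr t)" for b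
  proof (cases "b \<le> 0")
    case True
    have "exp_radius \<sigma> -` {..<b} = {}"
      using order_trans[OF True exp_radius_nonneg[OF \<sigma>]] by (auto simp: not_less[symmetric])
    then show ?thesis
      using True distance_distribution_0[OF \<sigma>] by (simp add: emeasure_distr ennreal_neg)
  next
    case False
    then have pos: "0 < \<sigma> (ennreal b)" "\<sigma> (ennreal b) < 1"
      using distance_distribution_pos[OF \<sigma>, of "ennreal b"] by (auto simp: ennreal_less_top)
    define L where "L = - ln (\<sigma> (ennreal b))"
    have L: "0 \<le> L" "exp (- L) = \<sigma> (ennreal b)"
      using pos by (auto simp: L_def)
    have iff: "exp_radius \<sigma> \<tau> < b \<longleftrightarrow> L < \<tau>" if "0 < \<tau>" for \<tau>
      using le_exp_radius_iff[OF \<sigma> that, of b] False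
      unfolding L(2)[symmetric] by auto
    have "emeasure ?N {..<b} = emeasure (density lborel (exp_density t)) (exp_radius \<sigma> -` {..<b})"
      by (simp add: emeasure_distr)
    also have "\<dots> = emeasure (density lborel (exp_density t)) {L<..}"
    proof (rule emeasure_eq_AE)
      show "AE \<tau> in density lborel (exp_density t). (\<tau> \<in> exp_radius \<sigma> -` {..<b}) = (\<tau> \<in> {L<..})"
        by (subst AE_density) (auto simp: exp_density_def iff)
      show "exp_radius \<sigma> -` {..<b} \<in> sets (density lborel (exp_density t))"
        using measurable_sets[OF measurable_exp_radius[OF \<sigma>], of "{..<b}"] by simp
    qed simp
    also have "\<dots> = ennreal (exp (- L * t))"
      by (rule emeasure_exp_density_greaterThan[OF t L(1)])
    also have "exp (- L * t) = \<sigma> (ennreal b) powr t"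
      using pos by (simp add: L_def powr_def mult.commute)
    finally show ?thesis .
  qed
  have sets_borel: "sets borel = sigma_sets UNIV (range lessThan :: real set set)"
    unfolding borel_Iio by simp
  \<comment> \<open>The open lower half-lines are closed under intersection and generate the Borel
    sets; those with natural endpoints exhaust the line and have finite mass.\<close>
  show ?thesis
  proof (rule measure_eqI_generator_eq[where E = "range lessThan" and \<Omega> = UNIV and A = "\<lambda>n::nat. {..<real n}"])
    have "{..<a} \<inter> {..<b} = {..<min a b}" for a b :: real
      by auto
    then show "Int_stable (range lessThan :: real set set)"
      by (auto simp: Int_stable_def)
    show "(\<Union>n::nat. {..<real n}) = UNIV"
      using reals_Archimedean2 by auto
  qed (auto simp: M N sets_stieltjes sets_borel)
qed

section \<open>Balls of the intrinsic metric and the spectral distribution\<close>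

text \<open>For \<open>r > 0\<close> the condition on \<open>y\<close> unfolds to
  \<open>\<sigma>(d x y) \<le> exp (- (1 / r))\<close>. For \<open>r = 0\<close> both balls are the
  singleton of \<open>x\<close>, and for negative \<open>r\<close> both are empty, so the radius is
  kept.\<close>

lemma closed_ball_intrinsic_metric:
  assumes "Metric_space UNIV d" and \<sigma>: "distance_distribution \<sigma>"
  shows "closed_ball (intrinsic_metric d \<sigma>) x r =
    closed_ball d x (if 0 < r then exp_radius \<sigma> (1 / r) else r)"
proof -
  interpret Metric_space UNIV d by fact
  have "intrinsic_metric d \<sigma> x y \<le> r \<longleftrightarrow> d x y \<le> (if 0 < r then exp_radius \<sigma> (1 / r) else r)" for y
  proof (cases "x = y")
    case True
    then show ?thesis
      using exp_radius_nonneg[OF \<sigma>, of "1 / r"] by (auto simp: intrinsic_metric_def)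
  next
    case False
    then have d: "0 < d x y"
      by simp
    define s where "s = \<sigma> (ennreal (d x y))"
    have s: "0 < s" "s < 1"
      using distance_distribution_pos[OF \<sigma>, of "ennreal (d x y)"] d by (auto simp: s_def)
    have eq: "intrinsic_metric d \<sigma> x y = 1 / (- ln s)"
      using False s by (simp add: intrinsic_metric_def s_def[symmetric] ln_div)
    have ln: "ln s < 0"
      using s by simp
    show ?thesis
    proof (cases "0 < r")
      case True
      have "intrinsic_metric d \<sigma> x y \<le> r \<longleftrightarrow> ln s \<le> - (1 / r)"
        unfolding eq using True ln by (simp add: field_simps)
      also have "\<dots> \<longleftrightarrow> s \<le> exp (- (1 / r))"
        using s by (metis ln_exp exp_gt_zero ln_le_cancel_iff)
      also have "\<dots> \<longleftrightarrow> d x y \<le> exp_radius \<sigma> (1 / r)"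
        using le_exp_radius_iff[OF \<sigma>, of "1 / r" "d x y"] True d by (simp add: s_def)
      finally show ?thesis
        using True by simp
    next
      case r: False
      have "0 < intrinsic_metric d \<sigma> x y"
        unfolding eq using ln by simp
      moreover have "r < d x y"
        using r d by linarith
      ultimately show ?thesis
        using r by simp
    qed
  qed
  then show ?thesis
    by (simp add: closed_ball_def)
qed

text \<open>This turns the cutoff of the Laplace integrals into the cutoff in the heat kernel. On
  the diagonal the quotient is infinite and both sides hold.\<close>

lemma le_inverse_intrinsic_metric_iff:
  assumes "Metric_space UNIV d" and \<sigma>: "distance_distribution \<sigma>" and \<tau>: "0 < \<tau>"
  shows "ennreal \<tau> \<le> 1 / ennreal (intrinsic_metric d \<sigma> x y) \<longleftrightarrow> d x y \<le> exp_radius \<sigma> \<tau>"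
proof -
  interpret Metric_space UNIV d by fact
  define e where "e = intrinsic_metric d \<sigma> x y"
  have "e \<le> 1 / \<tau> \<longleftrightarrow> d x y \<le> exp_radius \<sigma> \<tau>"
    using closed_ball_intrinsic_metric[OF assms(1) \<sigma>, of x "1 / \<tau>"] \<tau>
    by (simp add: closed_ball_def set_eq_iff e_def)
  moreover have "ennreal \<tau> \<le> 1 / ennreal e \<longleftrightarrow> e \<le> 1 / \<tau>"
  proof (cases "0 < e")
    case True
    then have "1 / ennreal e = ennreal (1 / e)"
      by (simp add: divide_ennreal flip: ennreal_1)
    then show ?thesis
      using True \<tau> by (simp add: field_simps)
  next
    case False
    then show ?thesis
      using \<tau> by (simp add: ennreal_neg order_trans[of e 0])
  qed
  ultimately show ?thesis
    by (simp add: e_def)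
qed

lemma spectral_distribution_intrinsic_metric:
  assumes "Metric_space UNIV d" "distance_distribution \<sigma>" "0 < \<tau>"
  shows "spectral_distribution (intrinsic_metric d \<sigma>) \<mu> x \<tau> =
    1 / emeasure \<mu> (closed_ball d x (exp_radius \<sigma> \<tau>))"
  using assms by (simp add: spectral_distribution_def closed_ball_intrinsic_metric)

section \<open>Measurability in the radius and in the spectral variable\<close>

text \<open>The measure of the ball is monotone in \<open>r\<close>, so sublevel sets are
  intervals.\<close>

lemma measurable_emeasure_closed_ball:
  assumes "\<And>r. closed_ball d x r \<in> sets \<mu>"
  shows "(\<lambda>r. emeasure \<mu> (closed_ball d x r)) \<in> borel_measurable borel"
proof (rule borel_measurableI_less)
  fix c
  have "emeasure \<mu> (closed_ball d x r) \<le> emeasure \<mu> (closed_ball d x s)" if "r \<le> s" for r s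
    using that assms by (intro emeasure_mono) (auto simp: closed_ball_def)
  then have "is_interval {r. emeasure \<mu> (closed_ball d x r) < c}"
    unfolding is_interval_1 by (blast intro: le_less_trans)
  then show "{r \<in> space borel. emeasure \<mu> (closed_ball d x r) < c} \<in> sets borel"
    by (simp add: real_interval_borel_measurable)
qed

lemma measurable_spectral_distribution:
  assumes "Metric_space UNIV d" and \<sigma>: "distance_distribution \<sigma>"
    and [measurable]: "\<And>r. closed_ball d x r \<in> sets \<mu>"
  shows "spectral_distribution (intrinsic_metric d \<sigma>) \<mu> x \<in> borel_measurable borel"
proof -
  note [measurable] = measurable_exp_radius[OF \<sigma>] measurable_emeasure_closed_ball[OF assms(3)]
  show ?thesis
    unfolding spectral_distribution_def closed_ball_intrinsic_metric[OF assms(1) \<sigma>]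
    by measurable
qed

text \<open>The numerator is an integral over \<open>y\<close> of a function jointly measurable in
  \<open>r\<close> and \<open>y\<close>; sigma-finiteness of \<open>\<mu>\<close> makes such a
  parametrised integral measurable.\<close>

lemma measurable_averaging:
  fixes \<mu> :: "'a::metric_space measure"
  assumes [measurable_cong]: "sets \<mu> = sets borel" and "sigma_finite_measure \<mu>"
    and [measurable]: "f \<in> borel_measurable \<mu>"
  shows "(\<lambda>r. averaging dist \<mu> r f x) \<in> borel_measurable borel"
proof -
  interpret sigma_finite_measure \<mu> by fact
  have [measurable]: "dist x \<in> borel_measurable \<mu>"
    by (simp add: measurable_cong_sets[OF assms(1) refl] borel_measurable_continuous_onI continuous_intros)
  have "(\<lambda>r. LINT y|\<mu>. (if dist x y \<le> r then f y else 0)) \<in> borel_measurable borel"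
    by measurable
  also have "(\<lambda>r. LINT y|\<mu>. (if dist x y \<le> r then f y else 0)) = (\<lambda>r. LINT y:closed_ball dist x r|\<mu>. f y)"
    by (intro ext) (auto simp: set_lebesgue_integral_def closed_ball_def intro!: Bochner_Integration.integral_cong)
  finally have [measurable]: "(\<lambda>r. LINT y:closed_ball dist x r|\<mu>. f y) \<in> borel_measurable borel" .
  have "closed_ball dist x r \<in> sets \<mu>" for r
    using closed_cball[of x r] by (simp add: assms(1) closed_ball_def cball_def)
  note [measurable] = measurable_emeasure_closed_ball[OF this]
  show ?thesis
    unfolding averaging_def measure_def by measurable
qed

section \<open>Equality of the two Markov operators\<close>

lemma isotropic_markov_eq_exponential:
  assumes \<sigma>: "distance_distribution \<sigma>"
    and [measurable]: "(\<lambda>r. averaging d \<mu> r f x) \<in> borel_measurable borel"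
  shows "isotropic_markov d \<mu> \<sigma> f x =
    (LINT \<tau>|density lborel (exp_density 1). averaging d \<mu> (exp_radius \<sigma> \<tau>) f x)"
proof -
  have \<sigma>1: "(\<lambda>r. \<sigma> r powr 1) = \<sigma>"
    using \<sigma> by (auto simp: distance_distribution_def)
  have "isotropic_markov d \<mu> \<sigma> f x =
      (LINT r|density (stieltjes \<sigma>) (\<lambda>r. ennreal (indicator {0..} r)). averaging d \<mu> r f x)"
    unfolding isotropic_markov_def set_lebesgue_integral_def
    by (subst integral_density) auto
  also have "density (stieltjes \<sigma>) (\<lambda>r. ennreal (indicator {0..} r)) =
      distr (density lborel (exp_density 1)) borel (exp_radius \<sigma>)"
    using stieltjes_powr_eq_distr[OF \<sigma> zero_less_one] unfolding \<sigma>1 by (simp add: ennreal_indicator)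
  finally show ?thesis
    by (simp add: integral_distr measurable_exp_radius[OF \<sigma>])
qed

text \<open>In the exponential variable the starred triple averages over the intrinsic ball of
  radius \<open>1 / \<tau>\<close>, which is the original ball of radius
  \<open>exp_radius \<sigma> \<tau>\<close>. The equality holds at every point
  \<open>x\<close>.\<close>

lemma isotropic_markov_intrinsic_metric:
  fixes \<mu> :: "'a::metric_space measure"
  assumes \<sigma>: "distance_distribution \<sigma>"
    and \<mu>: "sets \<mu> = sets borel" "sigma_finite_measure \<mu>" "f \<in> borel_measurable \<mu>"
  shows "isotropic_markov (intrinsic_metric dist \<sigma>) \<mu> sigma_star f x = isotropic_markov dist \<mu> \<sigma> f x"
proof -
  define g where "g r = (if 0 < r then exp_radius \<sigma> (1 / r) else r)" for r
  \<comment> \<open>Since \<open>g\<close> vanishes only at 0, the case \<open>r = 0\<close> of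
    \<open>averaging\<close>, the identity, occurs on both sides together.\<close>
  have g_0: "g r = 0 \<longleftrightarrow> r = 0" for r
    using exp_radius_pos[OF \<sigma>, of "1 / r"] by (auto simp: g_def)
  note [measurable] = measurable_averaging[OF \<mu>] measurable_exp_radius[OF \<sigma>]
    measurable_exp_radius[OF distance_distribution_sigma_star]
  have [measurable]: "g \<in> borel_measurable borel"
    unfolding g_def by measurable
  have ball: "closed_ball (intrinsic_metric dist \<sigma>) x r = closed_ball dist x (g r)" for r
    unfolding g_def by (rule closed_ball_intrinsic_metric[OF Met_TC.Metric_space_axioms \<sigma>])
  have avg: "averaging (intrinsic_metric dist \<sigma>) \<mu> r f x = averaging dist \<mu> (g r) f x" for r
    by (simp only: averaging_def g_0 ball)
  have "isotropic_markov (intrinsic_metric dist \<sigma>) \<mu> sigma_star f x =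
      (LINT \<tau>|density lborel (exp_density 1). averaging dist \<mu> (g (exp_radius sigma_star \<tau>)) f x)"
    by (subst isotropic_markov_eq_exponential[OF distance_distribution_sigma_star]) (simp_all add: avg)
  also have "\<dots> = (LINT \<tau>|density lborel (exp_density 1). averaging dist \<mu> (exp_radius \<sigma> \<tau>) f x)"
  proof (rule integral_cong_AE)
    show "AE \<tau> in density lborel (exp_density 1).
        averaging dist \<mu> (g (exp_radius sigma_star \<tau>)) f x = averaging dist \<mu> (exp_radius \<sigma> \<tau>) f x"
      by (subst AE_density) (auto simp: exp_density_def exp_radius_sigma_star g_def)
  qed measurable
  also have "\<dots> = isotropic_markov dist \<mu> \<sigma> f x"
    by (rule isotropic_markov_eq_exponential[OF \<sigma>, symmetric]) measurable
  finally show ?thesis .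
qed

section \<open>Integral formulas for the heat kernel\<close>

lemma heat_kernel_eq_laplace:
  assumes d: "Metric_space UNIV d" and \<sigma>: "distance_distribution \<sigma>" and t: "0 < t"
    and sets: "\<And>r. closed_ball d x r \<in> sets \<mu>"
  shows "heat_kernel d \<mu> \<sigma> t x y =
    (\<integral>\<^sup>+\<tau>\<in>{\<tau>. 0 \<le> \<tau> \<and> ennreal \<tau> \<le> 1 / ennreal (intrinsic_metric d \<sigma> x y)}.
      spectral_distribution (intrinsic_metric d \<sigma>) \<mu> x \<tau> * ennreal (t * exp (- \<tau> * t)) \<partial>lborel)"
proof -
  interpret Metric_space UNIV d by fact
  note [measurable] = measurable_exp_radius[OF \<sigma>] measurable_emeasure_closed_ball[OF sets]
  let ?h = "\<lambda>r. 1 / emeasure \<mu> (closed_ball d x r) * indicator {d x y..} r"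
  \<comment> \<open>The cutoff at \<open>d x y\<close> already forces \<open>r \<ge> 0\<close>, so
    restricting the measure to \<open>{0..}\<close> changes nothing.\<close>
  have "heat_kernel d \<mu> \<sigma> t x y =
      (\<integral>\<^sup>+r. ?h r \<partial>density (stieltjes (\<lambda>r. \<sigma> r powr t)) (indicator {0..}))"
    unfolding heat_kernel_def
    by (subst nn_integral_density) (auto intro!: nn_integral_cong simp: indicator_def order_trans[OF nonneg])
  also have "\<dots> = (\<integral>\<^sup>+\<tau>. exp_density t \<tau> * ?h (exp_radius \<sigma> \<tau>) \<partial>lborel)"
    unfolding stieltjes_powr_eq_distr[OF \<sigma> t]
    by (simp add: nn_integral_distr nn_integral_density)
  also have "\<dots> = (\<integral>\<^sup>+\<tau>\<in>{\<tau>. 0 \<le> \<tau> \<and> ennreal \<tau> \<le> 1 / ennreal (intrinsic_metric d \<sigma> x y)}.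
      spectral_distribution (intrinsic_metric d \<sigma>) \<mu> x \<tau> * ennreal (t * exp (- \<tau> * t)) \<partial>lborel)"
  \<comment> \<open>At \<open>\<tau> = 0\<close> the density is 0 while the right-hand integrand may
    be positive; this point is null.\<close>
  proof (rule nn_integral_cong_AE, use AE_lborel_singleton[of 0] in eventually_elim)
    fix \<tau> :: real assume "\<tau> \<noteq> 0"
    then show "exp_density t \<tau> * ?h (exp_radius \<sigma> \<tau>) =
      spectral_distribution (intrinsic_metric d \<sigma>) \<mu> x \<tau> * ennreal (t * exp (- \<tau> * t)) *
      indicator {\<tau>. 0 \<le> \<tau> \<and> ennreal \<tau> \<le> 1 / ennreal (intrinsic_metric d \<sigma> x y)} \<tau>"
      by (cases "0 < \<tau>")
         (auto simp: exp_density_def indicator_def spectral_distribution_intrinsic_metric[OF d \<sigma>]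
           le_inverse_intrinsic_metric_iff[OF d \<sigma>] mult.commute)
  qed
  finally show ?thesis .
qed

lemma ennreal_inverse_le_inverse: "a \<le> b \<Longrightarrow> inverse b \<le> inverse (a :: ennreal)"
  by (cases a; cases b; cases "a = 0")
     (auto simp: inverse_ennreal le_imp_inverse_le top_unique intro: ennreal_leI)

text \<open>Over the range of integration the ball behind \<open>N\<close> contains the one of
  radius \<open>d x y\<close>. This gives the constant majorant for finiteness and dominated
  convergence.\<close>

lemma spectral_distribution_intrinsic_metric_le:
  assumes d: "Metric_space UNIV d" and \<sigma>: "distance_distribution \<sigma>"
    and sets: "\<And>r. closed_ball d x r \<in> sets \<mu>"
    and \<tau>: "0 \<le> \<tau>" "ennreal \<tau> \<le> 1 / ennreal (intrinsic_metric d \<sigma> x y)"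
  shows "spectral_distribution (intrinsic_metric d \<sigma>) \<mu> x \<tau> \<le> 1 / emeasure \<mu> (closed_ball d x (d x y))"
proof (cases "\<tau> = 0")
  case True
  then show ?thesis
    using sets by (auto simp: spectral_distribution_def divide_ennreal_def emeasure_space intro!: ennreal_inverse_le_inverse)
next
  case False
  then have "closed_ball d x (d x y) \<subseteq> closed_ball d x (exp_radius \<sigma> \<tau>)"
    using \<tau> le_inverse_intrinsic_metric_iff[OF d \<sigma>, of \<tau> x y] by (auto simp: closed_ball_def)
  then have "emeasure \<mu> (closed_ball d x (d x y)) \<le> emeasure \<mu> (closed_ball d x (exp_radius \<sigma> \<tau>))"
    using sets by (intro emeasure_mono)
  then show ?thesis
    using False \<tau> by (simp add: spectral_distribution_intrinsic_metric[OF d \<sigma>] divide_ennreal_def ennreal_inverse_le_inverse)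
qed

lemma heat_kernel_eq_laplace_scaled:
  assumes d: "Metric_space UNIV d" and \<sigma>: "distance_distribution \<sigma>" and t: "0 < t"
    and sets: "\<And>r. closed_ball d x r \<in> sets \<mu>"
  defines "ds \<equiv> intrinsic_metric d \<sigma>"
  shows "heat_kernel d \<mu> \<sigma> t x y =
      ennreal t * (\<integral>\<^sup>+\<tau>\<in>{\<tau>. 0 \<le> \<tau> \<and> ennreal \<tau> \<le> 1 / ennreal (ds x y)}.
        spectral_distribution ds \<mu> x \<tau> * ennreal (exp (- \<tau> * t)) \<partial>lborel)" (is "_ = _ * ?I")
    and "heat_kernel d \<mu> \<sigma> t x y =
      (\<integral>\<^sup>+s\<in>{s. 0 \<le> s \<and> ennreal s \<le> ennreal t / ennreal (ds x y)}.
        spectral_distribution ds \<mu> x (s / t) * ennreal (exp (- s)) \<partial>lborel)" (is "_ = ?J")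
proof -
  note [measurable] = measurable_spectral_distribution[OF d \<sigma> sets, folded ds_def]
  show eq: "heat_kernel d \<mu> \<sigma> t x y = ennreal t * ?I"
    unfolding heat_kernel_eq_laplace[OF d \<sigma> t sets] ds_def[symmetric]
    using t by (simp add: nn_integral_cmult[symmetric] ennreal_mult' mult_ac)
  have set: "ennreal (t * \<tau>) \<le> ennreal t / ennreal e \<longleftrightarrow> ennreal \<tau> \<le> 1 / ennreal e" for \<tau> e
    using t by (simp add: ennreal_mult' ennreal_mult_le_mult_iff divide_ennreal_def)
  \<comment> \<open>Substitution \<open>s = t * \<tau>\<close>.\<close>
  have "?J = ennreal \<bar>t\<bar> * (\<integral>\<^sup>+\<tau>. spectral_distribution ds \<mu> x ((0 + t * \<tau>) / t) * ennreal (exp (- (0 + t * \<tau>))) *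
      indicator {s. 0 \<le> s \<and> ennreal s \<le> ennreal t / ennreal (ds x y)} (0 + t * \<tau>) \<partial>lborel)"
    by (rule nn_integral_real_affine) (use t in simp_all)
  also have "\<dots> = ennreal t * ?I"
    using t by (simp add: indicator_def set zero_le_mult_iff mult.commute[of _ t])
  finally show "heat_kernel d \<mu> \<sigma> t x y = ?J"
    by (simp add: eq)
qed

section \<open>Finiteness and continuity off the diagonal\<close>

lemma intrinsic_metric_pos:
  assumes "ultra_metric d" "distance_distribution \<sigma>" "x \<noteq> y"
  shows "0 < intrinsic_metric d \<sigma> x y"
proof -
  interpret Metric_space UNIV "intrinsic_metric d \<sigma>"
    using ultra_metric_intrinsic_metric[OF assms(1,2)] by (simp add: ultra_metric_def)
  show ?thesis
    using assms(3) by simp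
qed

text \<open>Off the diagonal the integral runs over the compact interval \<open>{0..1 / e}\<close>,
  on which the spectral distribution is at most the finite constant \<open>C\<close>.\<close>

lemma
  assumes ultra: "ultra_metric d" and \<sigma>: "distance_distribution \<sigma>" and t: "0 < t"
    and sets: "\<And>r. closed_ball d x r \<in> sets \<mu>"
    and pos: "0 < emeasure \<mu> (closed_ball d x (d x y))" and xy: "x \<noteq> y"
  shows heat_kernel_finite: "heat_kernel d \<mu> \<sigma> t x y < \<infinity>"
    and isCont_heat_kernel: "isCont (\<lambda>t. heat_kernel d \<mu> \<sigma> t x y) t"
proof -
  have d: "Metric_space UNIV d"
    using ultra by (simp add: ultra_metric_def)
  define e where "e = intrinsic_metric d \<sigma> x y"
  have e: "0 < e"
    unfolding e_def by (rule intrinsic_metric_pos[OF ultra \<sigma> xy])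
  define A where "A = {\<tau>. 0 \<le> \<tau> \<and> ennreal \<tau> \<le> 1 / ennreal e}"
  have A: "A = {0..1 / e}"
    using e by (auto simp: A_def divide_ennreal simp flip: ennreal_1)
  define C where "C = 1 / emeasure \<mu> (closed_ball d x (d x y))"
  have C: "C < \<infinity>"
    using pos by (simp add: C_def divide_ennreal_def less_top[symmetric])
  define F where "F \<tau> = spectral_distribution (intrinsic_metric d \<sigma>) \<mu> x \<tau> * indicator A \<tau>" for \<tau>
  have F_le: "F \<tau> \<le> C * indicator A \<tau>" for \<tau>
    using spectral_distribution_intrinsic_metric_le[OF d \<sigma> sets, of \<tau> y]
    by (auto simp: F_def C_def A_def e_def indicator_def)
  have F_fin: "F \<tau> < \<infinity>" for \<tau>
    using F_le[of \<tau>] C by (auto simp: indicator_def split: if_splits intro: le_less_trans)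
  have [measurable]: "F \<in> borel_measurable borel"
    unfolding F_def A
    by (intro borel_measurable_times_ennreal measurable_spectral_distribution[OF d \<sigma> sets]) simp_all
  define G where "G t = (\<integral>\<^sup>+\<tau>. F \<tau> * ennreal (t * exp (- \<tau> * t)) \<partial>lborel)" for t
  have eq: "heat_kernel d \<mu> \<sigma> t x y = G t" if "0 < t" for t
    unfolding heat_kernel_eq_laplace[OF d \<sigma> that sets]
    by (simp add: G_def F_def A_def e_def mult_ac)
  \<comment> \<open>The bound allows negative \<open>s\<close>, since a sequence converging to
    \<open>t\<close> may start with negative terms; this is why the exponential is bounded by
    \<open>exp (K / e)\<close> and not by 1.\<close>
  have dom: "F \<tau> * ennreal (s * exp (- \<tau> * s)) \<le> C * ennreal (K * exp (K / e)) * indicator A \<tau>"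
    if "\<bar>s\<bar> \<le> K" for s K \<tau>
  proof (cases "\<tau> \<in> A")
    case True
    then have \<tau>: "0 \<le> \<tau>" "\<tau> \<le> 1 / e"
      by (auto simp: A)
    have "- \<tau> * s \<le> \<tau> * K"
      using \<tau> that mult_left_mono[of "- s" K \<tau>] by simp
    also have "\<dots> \<le> K / e"
      using \<tau> that mult_right_mono[of \<tau> "1 / e" K] by simp
    finally have "s * exp (- \<tau> * s) \<le> K * exp (K / e)"
      using that by (intro mult_mono) auto
    then show ?thesis
      using F_le[of \<tau>] True by (auto intro!: mult_mono ennreal_leI)
  qed (simp add: F_def)
  have fin: "(\<integral>\<^sup>+\<tau>. C * ennreal (K * exp (K / e)) * indicator A \<tau> \<partial>lborel) < \<infinity>" for K
    using C e by (simp add: A nn_integral_cmult_indicator ennreal_mult_less_top)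
  show "heat_kernel d \<mu> \<sigma> t x y < \<infinity>"
    unfolding eq[OF t] G_def
    by (rule le_less_trans[OF nn_integral_mono fin[of t]]) (rule dom, use t in simp)
  have "isCont G t"
    unfolding continuous_at_sequentially
  proof (intro allI impI)
    fix X assume X: "X \<longlonglongrightarrow> t"
    then obtain K where K: "\<And>n. \<bar>X n\<bar> \<le> K"
      using Bseq_def[of X] convergent_imp_Bseq[of X] by (auto simp: convergent_def)
    have "(\<lambda>n. \<integral>\<^sup>+\<tau>. F \<tau> * ennreal (X n * exp (- \<tau> * X n)) \<partial>lborel) \<longlonglongrightarrow>
        (\<integral>\<^sup>+\<tau>. F \<tau> * ennreal (t * exp (- \<tau> * t)) \<partial>lborel)"
    proof (rule nn_integral_dominated_convergence[OF _ _ _ _ fin[of K]])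
      show "AE \<tau> in lborel. F \<tau> * ennreal (X n * exp (- \<tau> * X n)) \<le> C * ennreal (K * exp (K / e)) * indicator A \<tau>" for n
        using dom[OF K] by simp
      show "AE \<tau> in lborel. (\<lambda>n. F \<tau> * ennreal (X n * exp (- \<tau> * X n))) \<longlonglongrightarrow> F \<tau> * ennreal (t * exp (- \<tau> * t))"
        using F_fin by (intro AE_I2 ennreal_tendsto_cmult tendsto_ennrealI tendsto_intros X) simp
    qed (simp_all add: A)
    then show "(G \<circ> X) \<longlonglongrightarrow> G t"
      by (simp add: G_def comp_def)
  qed
  \<comment> \<open>The formula \<open>eq\<close> covers positive times only, which form a
    neighbourhood of \<open>t\<close>.\<close>
  moreover have "eventually (\<lambda>s. G s = heat_kernel d \<mu> \<sigma> s x y) (nhds t)"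
    using eventually_nhds_in_open[OF open_greaterThan, of t 0] t
    by (auto elim!: eventually_mono simp: eq)
  ultimately show "isCont (\<lambda>t. heat_kernel d \<mu> \<sigma> t x y) t"
    by (rule iffD1[OF isCont_cong, rotated])
qed

text \<open>By the ultra-metric inequality, moving each point by less than \<open>d x y\<close>
  preserves their distance and every ball around \<open>x\<close> of radius at least
  \<open>d x y\<close>. The kernel depends on the points through these data alone.\<close>

lemma heat_kernel_locally_constant:
  assumes ultra: "ultra_metric d" and x: "d x x' < d x y" and y: "d y y' < d x y"
  shows "heat_kernel d \<mu> \<sigma> t x' y' = heat_kernel d \<mu> \<sigma> t x y"
proof -
  interpret Metric_space UNIV d
    using ultra by (simp add: ultra_metric_def)
  have tri: "d a b \<le> max (d a c) (d c b)" for a b c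
    using ultra by (simp add: ultra_metric_def)
  have ball: "closed_ball d x' r = closed_ball d x r" if "d x y \<le> r" for r
  proof -
    have "d x' z \<le> r \<longleftrightarrow> d x z \<le> r" for z
      using tri[of x' z x] tri[of x z x'] commute[of x x'] x that by linarith
    then show ?thesis
      by (simp add: closed_ball_def)
  qed
  have "d x' y' = d x y"
    using tri[of x' y' x] tri[of x y' y] tri[of x y x'] tri[of x' y y'] commute[of x x'] commute[of y y'] x y
    by linarith
  then show ?thesis
    unfolding heat_kernel_def by (intro nn_integral_cong) (auto simp: indicator_def ball)
qed

text \<open>On the neighbourhood \<open>U\<close> of \<open>(t, x, y)\<close> the kernel equals the
  one with both points frozen, which leaves continuity in time.\<close>

lemma continuous_on_heat_kernel:
  fixes \<mu> :: "'a::metric_space measure"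
  assumes ultra: "ultra_metric (dist :: 'a \<Rightarrow> 'a \<Rightarrow> real)" and \<sigma>: "distance_distribution \<sigma>"
    and sets: "\<And>x r. closed_ball dist x r \<in> sets \<mu>"
    and pos: "\<And>x r. 0 < r \<Longrightarrow> 0 < emeasure \<mu> (closed_ball dist x r)"
  shows "continuous_on {(t, x, y). 0 < t \<and> x \<noteq> y} (\<lambda>(t, x, y). heat_kernel dist \<mu> \<sigma> t x y)"
proof (rule continuous_at_imp_continuous_on, clarify)
  fix t :: real and x y :: 'a
  assume t: "0 < t" and xy: "x \<noteq> y"
  define U where "U = (UNIV :: real set) \<times> ball x (dist x y) \<times> ball y (dist x y)"
  have U: "open U" "(t, x, y) \<in> U"
    using xy by (auto simp: U_def intro!: open_Times)
  have "isCont (\<lambda>t. heat_kernel dist \<mu> \<sigma> t x y) t"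
    by (rule isCont_heat_kernel[OF ultra \<sigma> t sets pos xy]) (use xy in simp)
  then have "isCont (\<lambda>z. heat_kernel dist \<mu> \<sigma> (fst z) x y) (t, x, y)"
    by (intro isCont_o2[where f = fst and g = "\<lambda>t. heat_kernel dist \<mu> \<sigma> t x y"] continuous_fst continuous_ident)
       (simp only: fst_conv)
  moreover have "eventually (\<lambda>z. heat_kernel dist \<mu> \<sigma> (fst z) x y = (\<lambda>(t, x, y). heat_kernel dist \<mu> \<sigma> t x y) z) (nhds (t, x, y))"
    using eventually_nhds_in_open[OF U]
  proof eventually_elim
    case (elim z)
    then obtain s x' y' where "z = (s, x', y')" "dist x x' < dist x y" "dist y y' < dist x y"
      by (cases z) (auto simp: U_def)
    then show ?case
      using heat_kernel_locally_constant[OF ultra, of x x' y y' \<mu> \<sigma> s] by simp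
  qed
  ultimately show "isCont (\<lambda>(t, x, y). heat_kernel dist \<mu> \<sigma> t x y) (t, x, y)"
    by (rule iffD1[OF isCont_cong, rotated])
qed

theorem theorem2p10:
  fixes \<mu> :: "'a::metric_space measure"
    and \<sigma> :: "ennreal \<Rightarrow> real"
    and d ds :: "'a \<Rightarrow> 'a \<Rightarrow> real"
    and p :: "real \<Rightarrow> 'a \<Rightarrow> 'a \<Rightarrow> ennreal"
    and N :: "'a \<Rightarrow> real \<Rightarrow> ennreal"
  defines "d \<equiv> dist"
    and "ds \<equiv> intrinsic_metric d \<sigma>"
    and "p \<equiv> heat_kernel d \<mu> \<sigma>"
    and "N \<equiv> spectral_distribution ds \<mu>"
  assumes "separable_space (euclidean :: 'a topology)"
    and "ultra_metric d"
    and "\<And>x r. compact (closed_ball d x r)"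
    and "radon_measure \<mu>"
    and "\<And>U. open U \<Longrightarrow> U \<noteq> {} \<Longrightarrow> emeasure \<mu> U > 0"
    and "distance_distribution \<sigma>"
  shows "same_L2_operator \<mu> (isotropic_markov d \<mu> \<sigma>) (isotropic_markov ds \<mu> sigma_star) \<and>
    (\<forall>x y t. t > 0 \<longrightarrow>
        p t x y = (\<integral>\<^sup>+ s\<in>{s. 0 \<le> s \<and> ennreal s \<le> ennreal t / ennreal (ds x y)}.
                     N x (s / t) * ennreal (exp (- s)) \<partial>lborel) \<and>
        p t x y = ennreal t * (\<integral>\<^sup>+ \<tau>\<in>{\<tau>. 0 \<le> \<tau> \<and> ennreal \<tau> \<le> 1 / ennreal (ds x y)}.
                     N x \<tau> * ennreal (exp (- \<tau> * t)) \<partial>lborel)) \<and>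
    (\<forall>x y t. t > 0 \<and> x \<noteq> y \<longrightarrow> p t x y < \<infinity>) \<and>
    continuous_on {(t, x, y). t > 0 \<and> x \<noteq> y} (\<lambda>(t, x, y). p t x y)"
proof -
  have d: "Metric_space UNIV d"
    by (simp add: d_def Met_TC.Metric_space_axioms)
  have sets: "sets \<mu> = sets borel" and fin: "compact K \<Longrightarrow> emeasure \<mu> K < \<infinity>" for K
    using assms(8) by (auto simp: radon_measure_def)
  have ball: "closed_ball d x r \<in> sets \<mu>" for x r
    by (simp add: sets borel_closed compact_imp_closed assms(7))
  have pos: "0 < emeasure \<mu> (closed_ball d x r)" if "0 < r" for x r
  proof -
    have "0 < emeasure \<mu> (ball x r)"
      using that by (intro assms(9)) auto
    also have "\<dots> \<le> emeasure \<mu> (closed_ball d x r)"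
      using ball by (intro emeasure_mono) (auto simp: closed_ball_def d_def)
    finally show ?thesis .
  qed
  \<comment> \<open>The balls of natural radius around an arbitrary centre cover the space and,
    being compact, have finite measure.\<close>
  have "sigma_finite_measure \<mu>"
  proof
    define B where "B = range (\<lambda>n::nat. closed_ball d undefined (real n))"
    have "\<Union>B = space \<mu>"
      using real_arch_simple sets_eq_imp_space_eq[OF sets] by (auto simp: B_def closed_ball_def)
    moreover have "countable B" "B \<subseteq> sets \<mu>" "\<forall>b\<in>B. emeasure \<mu> b \<noteq> \<infinity>"
      using ball fin[OF assms(7)] by (auto simp: B_def less_top)
    ultimately show "\<exists>B. countable B \<and> B \<subseteq> sets \<mu> \<and> \<Union>B = space \<mu> \<and> (\<forall>b\<in>B. emeasure \<mu> b \<noteq> \<infinity>)"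
      by blast
  qed
  then have "isotropic_markov d \<mu> \<sigma> f x = isotropic_markov ds \<mu> sigma_star f x"
    if "f \<in> borel_measurable \<mu>" for f x
    using isotropic_markov_intrinsic_metric[OF assms(10) sets _ that] by (simp add: ds_def d_def)
  moreover have "p t x y < \<infinity>" if "0 < t" "x \<noteq> y" for t x y
    unfolding p_def using that Metric_space.mdist_pos_eq[OF d, of x y]
    by (intro heat_kernel_finite assms(6,10) ball pos) auto
  moreover have "continuous_on {(t, x, y). t > 0 \<and> x \<noteq> y} (\<lambda>(t, x, y). p t x y)"
    using continuous_on_heat_kernel[OF assms(6)[unfolded d_def] assms(10), of \<mu>] ball pos
    by (simp add: p_def d_def)
  ultimately show ?thesis
    using heat_kernel_eq_laplace_scaled[OF d assms(10) _ ball]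
    by (auto simp: same_L2_operator_def square_integrable_def p_def N_def ds_def)
qed

end
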